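(* Let $\mu_d,\varepsilon_d,\xi_d,\zeta_d\in\mathbb{C}^{3n\times3n}$ satisfy: $\mu_d$ is Hermitian positive definite, $\Phi\equiv\varepsilon_d-\xi_d\mu_d^{-1}\zeta_d$ is Hermitian positive definite, and $\xi_d^{*}=\zeta_d$. Then all eigenvalues $\omega$ of the generalized eigenvalue problem $$\begin{bmatrix}C&0\\0&C^{*}\end{bmatrix}\begin{bmatrix}E\\H\end{bmatrix}=\omega\left(\imath\begin{bmatrix}\zeta_d&\mu_d\\-\varepsilon_d&-\xi_d\end{bmatrix}\right)\begin{bmatrix}E\\H\end{bmatrix},\qquad E,H\in\mathbb{C}^{3n},$$ are real.
   Context: Notation: $\imath=\sqrt{-1}$, $I_m$ is the $m\times m$ identity, $\otimes$ is the Kronecker product, $^{*}$ is the conjugate transpose. An eigenvalue is a number $\omega\in\mathbb{C}$ for which the equation has a nonzero solution $(E,H)$. $C\in\mathbb{C}^{3n\times 3n}$ is the discrete single-curl operator: $n_1,n_2,n_3\ge2$ are integers, $n=n_1n_2n_3$; $\delta_x,\delta_y,\delta_z>0$ are mesh lengths; $a>0$, $\mathbf{a}_\ell=a\,e_\ell$ with $e_\ell$ the $\ell$-th unit vector of $\mathbb{R}^3$; $\mathbf{k}\in\mathbb{R}^3$. For a vector $\mathbf{a}\in\mathbb{R}^3$ and integer $m\ge2$, $K_{\mathbf{a},m}\in\mathbb{C}^{m\times m}$ has $-1$ on the diagonal, $1$ on the first superdiagonal, $e^{\imath2\pi\mathbf{k}\cdot\mathbf{a}}$ in position $(m,1)$,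 and zeros elsewhere. Then $$C_1=\delta_x^{-1}(I_{n_3}\otimes I_{n_2}\otimes K_{\mathbf{a}_1,n_1}),\quad C_2=\delta_y^{-1}(I_{n_3}\otimes K_{\mathbf{a}_2,n_2}\otimes I_{n_1}),\quad C_3=\delta_z^{-1}(K_{\mathbf{a}_3,n_3}\otimes I_{n_2}\otimes I_{n_1}),$$ $$C=\begin{bmatrix}0&-C_3&C_2\\ C_3&0&-C_1\\ -C_2&C_1&0\end{bmatrix}.$$ *)

theory Defs
  imports
    Complex_Main
    "Jordan_Normal_Form.Gauss_Jordan_Elimination"
    "Jordan_Normal_Form.Schur_Decomposition"
begin

definition hermitian_mat :: "complex mat \<Rightarrow> bool" where
  "hermitian_mat A \<longleftrightarrow> square_mat A \<and> mat_adjoint A = A"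

text \<open>For Hermitian \<open>A\<close> the number \<open>v\<^sup>* A v\<close>, written \<open>(A *\<^sub>v v) \<bullet>c v\<close>, is real, so taking
  the real part loses nothing.\<close>

definition hermitian_pos_def :: "complex mat \<Rightarrow> bool" where
  "hermitian_pos_def A \<longleftrightarrow> hermitian_mat A \<and>
     (\<forall>v \<in> carrier_vec (dim_row A). v \<noteq> 0\<^sub>v (dim_row A) \<longrightarrow> 0 < Re ((A *\<^sub>v v) \<bullet>c v))"

text \<open>Eigenvalues of the generalized problem \<open>A x = \<omega> B x\<close>. If \<open>A\<close> and \<open>B\<close> are \<open>2 \<times> 2\<close> block
  matrices, then \<open>x\<close> is the stacked unknown \<open>E @\<^sub>v H\<close>.\<close>

definition gen_eigenvalue :: "complex mat \<Rightarrow> complex mat \<Rightarrow> complex \<Rightarrow> bool" where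
  "gen_eigenvalue A B \<omega> \<longleftrightarrow>
     (\<exists>x \<in> carrier_vec (dim_col A). x \<noteq> 0\<^sub>v (dim_col A) \<and> A *\<^sub>v x = \<omega> \<cdot>\<^sub>v (B *\<^sub>v x))"

definition kronecker :: "'a :: semiring_1 mat \<Rightarrow> 'a mat \<Rightarrow> 'a mat"  (infixr "\<otimes>\<^sub>K" 75) where
  "A \<otimes>\<^sub>K B = mat (dim_row A * dim_row B) (dim_col A * dim_col B)
     (\<lambda>(i, j). A $$ (i div dim_row B, j div dim_col B) * B $$ (i mod dim_row B, j mod dim_col B))"

text \<open>The \<open>3 \<times> 3\<close> block matrix whose blocks, all of size \<open>m \<times> m\<close>, are listed row by row.\<close>

definition block3_mat :: "nat \<Rightarrow> 'a mat list list \<Rightarrow> 'a mat" where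
  "block3_mat m Bs = mat (3 * m) (3 * m)
     (\<lambda>(i, j). (Bs ! (i div m) ! (j div m)) $$ (i mod m, j mod m))"

text \<open>Indices of vectors and matrices start at \<open>0\<close>: position \<open>(m, 1)\<close> is index \<open>(m - 1, 0)\<close>, and
  \<open>unit_vec 3 0\<close>, \<open>unit_vec 3 1\<close>, \<open>unit_vec 3 2\<close> are the unit vectors \<open>e\<^sub>1, e\<^sub>2, e\<^sub>3\<close> of three-space.\<close>

definition K_mat :: "real vec \<Rightarrow> real vec \<Rightarrow> nat \<Rightarrow> complex mat" where
  "K_mat k a m = mat m m (\<lambda>(i, j).
     if i = j then -1
     else if j = i + 1 then 1
     else if i = m - 1 \<and> j = 0 then exp (\<i> * 2 * complex_of_real pi * complex_of_real (k \<bullet> a))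
     else 0)"

definition C1_mat :: "nat \<Rightarrow> nat \<Rightarrow> nat \<Rightarrow> real \<Rightarrow> real \<Rightarrow> real vec \<Rightarrow> complex mat" where
  "C1_mat n1 n2 n3 \<delta>x a k = complex_of_real (inverse \<delta>x) \<cdot>\<^sub>m
     (1\<^sub>m n3 \<otimes>\<^sub>K 1\<^sub>m n2 \<otimes>\<^sub>K K_mat k (a \<cdot>\<^sub>v unit_vec 3 0) n1)"

definition C2_mat :: "nat \<Rightarrow> nat \<Rightarrow> nat \<Rightarrow> real \<Rightarrow> real \<Rightarrow> real vec \<Rightarrow> complex mat" where
  "C2_mat n1 n2 n3 \<delta>y a k = complex_of_real (inverse \<delta>y) \<cdot>\<^sub>m
     (1\<^sub>m n3 \<otimes>\<^sub>K K_mat k (a \<cdot>\<^sub>v unit_vec 3 1) n2 \<otimes>\<^sub>K 1\<^sub>m n1)"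

definition C3_mat :: "nat \<Rightarrow> nat \<Rightarrow> nat \<Rightarrow> real \<Rightarrow> real \<Rightarrow> real vec \<Rightarrow> complex mat" where
  "C3_mat n1 n2 n3 \<delta>z a k = complex_of_real (inverse \<delta>z) \<cdot>\<^sub>m
     (K_mat k (a \<cdot>\<^sub>v unit_vec 3 2) n3 \<otimes>\<^sub>K 1\<^sub>m n2 \<otimes>\<^sub>K 1\<^sub>m n1)"

definition curl_mat ::
  "nat \<Rightarrow> nat \<Rightarrow> nat \<Rightarrow> real \<Rightarrow> real \<Rightarrow> real \<Rightarrow> real \<Rightarrow> real vec \<Rightarrow> complex mat" where
  "curl_mat n1 n2 n3 \<delta>x \<delta>y \<delta>z a k =
     (let n = n1 * n2 * n3; Z = 0\<^sub>m n n;
          C1 = C1_mat n1 n2 n3 \<delta>x a k;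
          C2 = C2_mat n1 n2 n3 \<delta>y a k;
          C3 = C3_mat n1 n2 n3 \<delta>z a k
      in block3_mat n
           [[Z,     - C3,  C2  ],
            [C3,    Z,     - C1],
            [- C2,  C1,    Z   ]])"

end

theory Submission
  imports Defs
begin

text \<open>
  Reading the second block row first, and multiplying the two block rows by \<open>\<i>\<close> and \<open>- \<i>\<close>,
  turns the eigenvalue problem into \<open>A x = \<omega> M x\<close> with \<open>x\<close> the stacked vector of \<open>E\<close> and \<open>H\<close>,
  and with the block matrices
  \<open>A = [[0, \<i> C\<^sup>*], [- \<i> C, 0]]\<close> and \<open>M = [[\<epsilon>, \<xi>], [\<zeta>, \<mu>]]\<close>.
  The matrix \<open>A\<close> is Hermitian, so \<open>x\<^sup>* A x\<close> is real, and \<open>\<omega>\<close> is real as soon as \<open>x\<^sup>* M x\<close> is real and nonzero.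

  Now \<open>\<Phi>\<close> is the Schur complement of \<open>\<mu>\<close> in \<open>M\<close>. Since \<open>\<xi>\<^sup>* = \<zeta>\<close>, completing the square gives
  \<open>x\<^sup>* M x = E\<^sup>* \<Phi> E + (H + w)\<^sup>* \<mu> (H + w)\<close> with \<open>w = \<mu>\<^sup>-\<^sup>1 \<zeta> E\<close>,
  and both terms are forms of positive definite matrices. They cannot both vanish: if \<open>E = 0\<close>
  then \<open>w = 0\<close>, and so \<open>H + w = H \<noteq> 0\<close>. This is \<open>schur_complement_form_pos\<close>; the comparison of
  the two forms is \<open>bianisotropic_eigenvalue_real\<close>.
\<close>

section \<open>The complex inner product and adjoint matrices\<close>

lemma mat_adjoint_carrier:
  assumes "A \<in> carrier_mat m n"
  shows "mat_adjoint A \<in> carrier_mat n m"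
proof -
  have "dim_row (mat_adjoint A) = n" "dim_col (mat_adjoint A) = m"
    using assms by (auto simp: mat_adjoint_def mat_of_rows_def)
  then show ?thesis by (rule carrier_matI)
qed

lemma cscalar_prod_mat_adjoint:
  assumes A: "(A :: complex mat) \<in> carrier_mat m n"
    and v: "v \<in> carrier_vec n" and w: "w \<in> carrier_vec m"
  shows "(A *\<^sub>v v) \<bullet>c w = v \<bullet>c (mat_adjoint A *\<^sub>v w)"
proof -
  have dims: "dim_row A = m" "dim_col A = n" "dim_vec v = n" "dim_vec w = m"
    using A v w by auto
  have "(A *\<^sub>v v) \<bullet>c w = (\<Sum>i<m. \<Sum>j<n. A $$ (i, j) * v $ j * cnj (w $ i))"
    by (auto simp: scalar_prod_def sum_distrib_right lessThan_atLeast0 dims intro!: sum.cong)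
  also have "\<dots> = (\<Sum>j<n. \<Sum>i<m. A $$ (i, j) * v $ j * cnj (w $ i))"
    by (rule sum.swap)
  also have "\<dots> = v \<bullet>c (mat_adjoint A *\<^sub>v w)"
    by (auto simp: scalar_prod_def sum_distrib_left lessThan_atLeast0 mat_adjoint_def
        mat_of_rows_index dims ac_simps intro!: sum.cong)
  finally show ?thesis .
qed

lemma smult_mat_mult_vec:
  assumes "A \<in> carrier_mat m n" "v \<in> carrier_vec n"
  shows "(c \<cdot>\<^sub>m A) *\<^sub>v v = (c :: 'a :: comm_semiring_1) \<cdot>\<^sub>v (A *\<^sub>v v)"
  using assms by (intro eq_vecI) auto

lemma smult_smult_append_uminus:
  assumes "(u :: complex vec) \<in> carrier_vec m" "v \<in> carrier_vec n"
  shows "c \<cdot>\<^sub>v (d \<cdot>\<^sub>v (u @\<^sub>v - v)) = ((c * d) \<cdot>\<^sub>v u) @\<^sub>v ((- c * d) \<cdot>\<^sub>v v)"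
  using assms by (intro eq_vecI) auto

lemma cnj_cscalar_prod:
  assumes "(v :: complex vec) \<in> carrier_vec n" "w \<in> carrier_vec n"
  shows "cnj (v \<bullet>c w) = w \<bullet>c v"
  using assms by (auto simp: scalar_prod_def mult.commute intro!: sum.cong)

lemma cscalar_prod_add_right:
  assumes "(u :: complex vec) \<in> carrier_vec n" "v \<in> carrier_vec n" "w \<in> carrier_vec n"
  shows "u \<bullet>c (v + w) = u \<bullet>c v + u \<bullet>c w"
  using assms by (simp add: conjugate_add_vec scalar_prod_add_distrib[of _ n])

section \<open>Forms of Hermitian and positive definite matrices\<close>

lemma hermitian_form_swap:
  assumes "hermitian_mat A" "A \<in> carrier_mat n n" "v \<in> carrier_vec n" "w \<in> carrier_vec n"
  shows "(A *\<^sub>v v) \<bullet>c w = v \<bullet>c (A *\<^sub>v w)"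
  using cscalar_prod_mat_adjoint[of A n n v w] assms by (simp add: hermitian_mat_def)

lemma hermitian_form_real:
  assumes "hermitian_mat A" "A \<in> carrier_mat n n" "v \<in> carrier_vec n"
  shows "(A *\<^sub>v v) \<bullet>c v \<in> \<real>"
  using hermitian_form_swap[OF assms assms(3)] cnj_cscalar_prod[of "A *\<^sub>v v" n v] assms
  by (simp add: Reals_cnj_iff)

text \<open>At a vector of the kernel the form vanishes, so the kernel is trivial, the determinant is
  nonzero and Gauss-Jordan elimination does return an inverse.\<close>

lemma pos_def_mat_inverse:
  assumes pd: "hermitian_pos_def A" and A: "A \<in> carrier_mat n n"
  shows "the (mat_inverse A) \<in> carrier_mat n n" "A * the (mat_inverse A) = 1\<^sub>m n"
proof -
  have "v = 0\<^sub>v n" if v: "v \<in> carrier_vec n" and Av: "A *\<^sub>v v = 0\<^sub>v n" for v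
  proof (rule ccontr)
    assume "v \<noteq> 0\<^sub>v n"
    then have "0 < Re ((A *\<^sub>v v) \<bullet>c v)"
      using pd A v by (simp add: hermitian_pos_def_def)
    then show False using v by (simp add: Av)
  qed
  then have "det A \<noteq> 0"
    using det_0_iff_vec_prod_zero_field[OF A] by blast
  from det_non_zero_imp_unit[OF A this, of "()"] mat_inverse(1)[OF A, of "()"]
  obtain B where "mat_inverse A = Some B"
    by (cases "mat_inverse A") simp_all
  with mat_inverse(2)[OF A this]
  show "the (mat_inverse A) \<in> carrier_mat n n" "A * the (mat_inverse A) = 1\<^sub>m n"
    by auto
qed

lemma pos_def_form:
  assumes "hermitian_pos_def A" "A \<in> carrier_mat n n" "v \<in> carrier_vec n"
  obtains r where "(A *\<^sub>v v) \<bullet>c v = complex_of_real r" "0 \<le> r" "v \<noteq> 0\<^sub>v n \<longrightarrow> 0 < r"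
proof
  show "(A *\<^sub>v v) \<bullet>c v = complex_of_real (Re ((A *\<^sub>v v) \<bullet>c v))"
    using hermitian_form_real[of A n v] assms by (simp add: hermitian_pos_def_def)
  show pos: "v \<noteq> 0\<^sub>v n \<longrightarrow> 0 < Re ((A *\<^sub>v v) \<bullet>c v)"
    using assms by (auto simp: hermitian_pos_def_def)
  show "0 \<le> Re ((A *\<^sub>v v) \<bullet>c v)"
    using pos assms by (cases "v = 0\<^sub>v n") auto
qed

section \<open>The Schur complement\<close>

text \<open>Completing the square in \<open>H\<close>. The claim is stated for the form rather than as positive
  definiteness of the block matrix, because the two summands on the left are what the two block
  rows of the eigenvalue equation produce.\<close>

lemma schur_complement_form_pos:
  assumes carr: "\<mu> \<in> carrier_mat n n" "\<epsilon> \<in> carrier_mat n n" "\<xi> \<in> carrier_mat n n"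
      "\<zeta> \<in> carrier_mat n n"
    and vecs: "E \<in> carrier_vec n" "H \<in> carrier_vec n"
    and \<mu>: "hermitian_pos_def \<mu>"
    and \<Phi>: "hermitian_pos_def (\<epsilon> - \<xi> * the (mat_inverse \<mu>) * \<zeta>)"
    and adj: "mat_adjoint \<xi> = \<zeta>"
    and nz: "E \<noteq> 0\<^sub>v n \<or> H \<noteq> 0\<^sub>v n"
  obtains r where "(\<epsilon> *\<^sub>v E + \<xi> *\<^sub>v H) \<bullet>c E + (\<zeta> *\<^sub>v E + \<mu> *\<^sub>v H) \<bullet>c H = complex_of_real r" "0 < r"
proof -
  define N where "N = the (mat_inverse \<mu>)"
  define w where "w = N *\<^sub>v (\<zeta> *\<^sub>v E)"
  have N: "N \<in> carrier_mat n n" "\<mu> * N = 1\<^sub>m n"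
    using pos_def_mat_inverse[OF \<mu> carr(1)] by (simp_all add: N_def)
  have w: "w \<in> carrier_vec n" using N carr vecs by (auto simp: w_def)
  have mats: "\<epsilon> *\<^sub>v E \<in> carrier_vec n" "\<xi> *\<^sub>v H \<in> carrier_vec n" "\<xi> *\<^sub>v w \<in> carrier_vec n"
      "\<zeta> *\<^sub>v E \<in> carrier_vec n" "\<mu> *\<^sub>v H \<in> carrier_vec n"
    using carr vecs w by auto
  have \<mu>w: "\<mu> *\<^sub>v w = \<zeta> *\<^sub>v E"
    unfolding w_def assoc_mult_mat_vec[OF carr(1) N(1) mats(4), symmetric] N(2)
    using mats(4) by simp
  have herm: "hermitian_mat \<mu>" using \<mu> by (simp add: hermitian_pos_def_def)
  have \<xi>: "(\<xi> *\<^sub>v v) \<bullet>c E = v \<bullet>c (\<zeta> *\<^sub>v E)" if "v \<in> carrier_vec n" for v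
    using cscalar_prod_mat_adjoint[OF carr(3) that vecs(1)] adj by simp
  have \<mu>_w: "(\<mu> *\<^sub>v v) \<bullet>c w = v \<bullet>c (\<zeta> *\<^sub>v E)" if "v \<in> carrier_vec n" for v
    using hermitian_form_swap[OF herm carr(1) that w] \<mu>w by simp
  let ?\<Phi> = "\<epsilon> - \<xi> * N * \<zeta>"
  have "?\<Phi> *\<^sub>v E = \<epsilon> *\<^sub>v E - \<xi> *\<^sub>v w"
    using carr vecs N
    by (simp add: w_def minus_mult_distrib_mat_vec[of _ n n] assoc_mult_mat_vec[of _ n n _ n])
  then have \<Phi>E: "(?\<Phi> *\<^sub>v E) \<bullet>c E = (\<epsilon> *\<^sub>v E) \<bullet>c E - w \<bullet>c (\<zeta> *\<^sub>v E)"
    using mats vecs w by (simp add: minus_scalar_prod_distrib[of _ n] \<xi>)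
  \<comment> \<open>Expand the square, moving \<open>\<mu>\<close> onto \<open>w\<close> wherever \<open>w\<close> occurs, so that only
    \<open>\<mu> w = \<zeta> E\<close> remains and no inverse is left.\<close>
  have "(\<mu> *\<^sub>v (H + w)) \<bullet>c (H + w) = (\<mu> *\<^sub>v H + \<zeta> *\<^sub>v E) \<bullet>c H + (H \<bullet>c (\<zeta> *\<^sub>v E) + w \<bullet>c (\<zeta> *\<^sub>v E))"
    using carr vecs w mats
    by (simp add: mult_add_distrib_mat_vec[of _ n n] cscalar_prod_add_right[of _ n]
        add_scalar_prod_distrib[of _ n] \<mu>_w flip: \<mu>w)
  then have sq: "(\<epsilon> *\<^sub>v E + \<xi> *\<^sub>v H) \<bullet>c E + (\<zeta> *\<^sub>v E + \<mu> *\<^sub>v H) \<bullet>c H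
      = (?\<Phi> *\<^sub>v E) \<bullet>c E + (\<mu> *\<^sub>v (H + w)) \<bullet>c (H + w)"
    using mats vecs \<Phi>E by (simp add: add_scalar_prod_distrib[of _ n] \<xi>)
  have \<Phi>': "?\<Phi> \<in> carrier_mat n n" using carr N by auto
  obtain r where r: "(?\<Phi> *\<^sub>v E) \<bullet>c E = complex_of_real r" "0 \<le> r" "E \<noteq> 0\<^sub>v n \<longrightarrow> 0 < r"
    by (rule pos_def_form[OF \<Phi>[folded N_def] \<Phi>' vecs(1)])
  have Hw: "H + w \<in> carrier_vec n" using vecs w by simp
  obtain s where s: "(\<mu> *\<^sub>v (H + w)) \<bullet>c (H + w) = complex_of_real s" "0 \<le> s"
      "H + w \<noteq> 0\<^sub>v n \<longrightarrow> 0 < s"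
    by (rule pos_def_form[OF \<mu> carr(1) Hw])
  \<comment> \<open>For \<open>E = 0\<close> the shift \<open>w\<close> vanishes, so positivity must come from \<open>H\<close>.\<close>
  have "H + w = H" if "E = 0\<^sub>v n"
  proof -
    have "A *\<^sub>v 0\<^sub>v n = 0\<^sub>v n" if "A \<in> carrier_mat n n" for A :: "complex mat"
      using that by (intro eq_vecI) auto
    then show ?thesis
      using that carr N vecs by (simp add: w_def)
  qed
  then have "0 < r + s"
    using r(2,3) s(2,3) nz by (cases "E = 0\<^sub>v n") auto
  with sq r(1) s(1) show thesis by (intro that[of "r + s"]) auto
qed

section \<open>Reality of the eigenvalues\<close>

text \<open>Pairing the first block row with \<open>H\<close> and the second with \<open>E\<close> yields two conjugate numbers,
  \<open>p = H\<^sup>* C E\<close> and \<open>E\<^sup>* C\<^sup>* H\<close>. The combination \<open>\<i> cnj p - \<i> p\<close> is the Hermitian form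
  \<open>x\<^sup>* A x\<close>; it equals \<open>2 Im p\<close>, and by the equations also \<open>\<omega>\<close> times the positive
  form of the material matrix.\<close>

lemma bianisotropic_eigenvalue_real:
  assumes C: "C \<in> carrier_mat n n"
    and carr: "\<mu> \<in> carrier_mat n n" "\<epsilon> \<in> carrier_mat n n" "\<xi> \<in> carrier_mat n n"
      "\<zeta> \<in> carrier_mat n n"
    and \<mu>: "hermitian_pos_def \<mu>"
    and \<Phi>: "hermitian_pos_def (\<epsilon> - \<xi> * the (mat_inverse \<mu>) * \<zeta>)"
    and adj: "mat_adjoint \<xi> = \<zeta>"
    and eig: "gen_eigenvalue (four_block_mat C (0\<^sub>m n n) (0\<^sub>m n n) (mat_adjoint C))
        (\<i> \<cdot>\<^sub>m four_block_mat \<zeta> \<mu> (- \<epsilon>) (- \<xi>)) \<omega>"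
  shows "\<omega> \<in> \<real>"
proof -
  have C': "mat_adjoint C \<in> carrier_mat n n" by (rule mat_adjoint_carrier[OF C])
  let ?B = "four_block_mat \<zeta> \<mu> (- \<epsilon>) (- \<xi>)"
  obtain x where x: "x \<in> carrier_vec (n + n)" "x \<noteq> 0\<^sub>v (n + n)"
    and eq: "four_block_mat C (0\<^sub>m n n) (0\<^sub>m n n) (mat_adjoint C) *\<^sub>v x
        = \<omega> \<cdot>\<^sub>v ((\<i> \<cdot>\<^sub>m ?B) *\<^sub>v x)"
    using eig C C' by (auto simp: gen_eigenvalue_def)
  define E H where "E = vec_first x n" and "H = vec_last x n"
  have vecs: "E \<in> carrier_vec n" "H \<in> carrier_vec n" and xEH: "x = E @\<^sub>v H"
    using x by (auto simp: E_def H_def)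
  have nz: "E \<noteq> 0\<^sub>v n \<or> H \<noteq> 0\<^sub>v n"
    using x(2) xEH by auto
  let ?u = "\<zeta> *\<^sub>v E + \<mu> *\<^sub>v H" and ?v = "\<epsilon> *\<^sub>v E + \<xi> *\<^sub>v H"
  have uv: "?u \<in> carrier_vec n" "?v \<in> carrier_vec n"
    using carr vecs by auto
  have B: "?B *\<^sub>v x = ?u @\<^sub>v - ?v"
    unfolding xEH using carr vecs
    by (subst four_block_mat_mult_vec[of _ n n _ n _ n]) auto
  have "?B \<in> carrier_mat (n + n) (n + n)" using carr by auto
  then have "\<omega> \<cdot>\<^sub>v ((\<i> \<cdot>\<^sub>m ?B) *\<^sub>v x) = \<omega> \<cdot>\<^sub>v (\<i> \<cdot>\<^sub>v (?u @\<^sub>v - ?v))"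
    by (simp add: smult_mat_mult_vec[OF _ x(1)] B)
  also have "\<dots> = ((\<omega> * \<i>) \<cdot>\<^sub>v ?u) @\<^sub>v ((- \<omega> * \<i>) \<cdot>\<^sub>v ?v)"
    by (rule smult_smult_append_uminus[OF uv])
  finally have "\<omega> \<cdot>\<^sub>v ((\<i> \<cdot>\<^sub>m ?B) *\<^sub>v x) = ((\<omega> * \<i>) \<cdot>\<^sub>v ?u) @\<^sub>v ((- \<omega> * \<i>) \<cdot>\<^sub>v ?v)" .
  moreover have "four_block_mat C (0\<^sub>m n n) (0\<^sub>m n n) (mat_adjoint C) *\<^sub>v x
      = (C *\<^sub>v E) @\<^sub>v (mat_adjoint C *\<^sub>v H)"
    unfolding xEH by (rule mult_mat_vec_split[OF C C' vecs])
  ultimately have eqs: "C *\<^sub>v E = (\<omega> * \<i>) \<cdot>\<^sub>v ?u" "mat_adjoint C *\<^sub>v H = (- \<omega> * \<i>) \<cdot>\<^sub>v ?v"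
    using eq C uv vecs append_vec_eq[of "C *\<^sub>v E" n "(\<omega> * \<i>) \<cdot>\<^sub>v ?u"] by auto
  define p where "p = (C *\<^sub>v E) \<bullet>c H"
  have p1: "p = \<omega> * \<i> * (?u \<bullet>c H)"
    using uv vecs by (simp add: p_def eqs)
  have "cnj p = (mat_adjoint C *\<^sub>v H) \<bullet>c E"
    using cscalar_prod_mat_adjoint[OF C vecs] C' vecs
    by (simp add: p_def cnj_cscalar_prod[of _ n])
  then have p2: "cnj p = - \<omega> * \<i> * (?v \<bullet>c E)"
    using uv vecs by (simp add: eqs)
  obtain r where r: "?v \<bullet>c E + ?u \<bullet>c H = complex_of_real r" "0 < r"
    by (rule schur_complement_form_pos[OF carr vecs \<mu> \<Phi> adj nz])
  have "\<i> * cnj p = \<omega> * (?v \<bullet>c E)"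
    unfolding p2 by (simp add: algebra_simps)
  moreover have "- (\<i> * p) = \<omega> * (?u \<bullet>c H)"
    unfolding p1 by (simp add: algebra_simps)
  ultimately have "\<i> * cnj p - \<i> * p = \<omega> * (?v \<bullet>c E + ?u \<bullet>c H)"
    by (simp add: distrib_left)
  then have "\<i> * cnj p - \<i> * p = \<omega> * complex_of_real r"
    by (simp add: r(1))
  moreover have "\<i> * cnj p - \<i> * p = complex_of_real (2 * Im p)"
    by (simp add: complex_eq_iff)
  ultimately have "\<omega> = complex_of_real (2 * Im p / r)"
    using r(2) by (simp add: field_simps)
  then show ?thesis by (metis Reals_of_real)
qed

theorem theorem4p1:
  fixes n1 n2 n3 n :: nat
    and \<delta>x \<delta>y \<delta>z a :: real
    and k :: "real vec"
    and C \<mu> \<epsilon> \<xi> \<zeta> \<Phi> :: "complex mat"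
  assumes "n1 \<ge> 2" and "n2 \<ge> 2" and "n3 \<ge> 2" and "n = n1 * n2 * n3"
    and "\<delta>x > 0" and "\<delta>y > 0" and "\<delta>z > 0" and "a > 0"
    and "k \<in> carrier_vec 3"
    and "C = curl_mat n1 n2 n3 \<delta>x \<delta>y \<delta>z a k"
    and "\<mu> \<in> carrier_mat (3 * n) (3 * n)" and "\<epsilon> \<in> carrier_mat (3 * n) (3 * n)"
    and "\<xi> \<in> carrier_mat (3 * n) (3 * n)" and "\<zeta> \<in> carrier_mat (3 * n) (3 * n)"
    and "hermitian_pos_def \<mu>"
    and "\<Phi> = \<epsilon> - \<xi> * the (mat_inverse \<mu>) * \<zeta>"
    and "hermitian_pos_def \<Phi>"
    and "mat_adjoint \<xi> = \<zeta>"
  shows "\<forall>\<omega>. gen_eigenvalue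
           (four_block_mat C (0\<^sub>m (3 * n) (3 * n)) (0\<^sub>m (3 * n) (3 * n)) (mat_adjoint C))
           (\<i> \<cdot>\<^sub>m four_block_mat \<zeta> \<mu> (- \<epsilon>) (- \<xi>)) \<omega>
         \<longrightarrow> \<omega> \<in> \<real>"
proof (intro allI impI)
  fix \<omega>
  assume eig: "gen_eigenvalue
      (four_block_mat C (0\<^sub>m (3 * n) (3 * n)) (0\<^sub>m (3 * n) (3 * n)) (mat_adjoint C))
      (\<i> \<cdot>\<^sub>m four_block_mat \<zeta> \<mu> (- \<epsilon>) (- \<xi>)) \<omega>"
  have "C \<in> carrier_mat (3 * n) (3 * n)"
    using assms(4,10) by (simp add: curl_mat_def block3_mat_def Let_def)
  then show "\<omega> \<in> \<real>"
    using bianisotropic_eigenvalue_real[OF _ assms(11-15) _ assms(18) eig] assms(16,17)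
    by simp
qed

end
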